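(* Let $n\ge2$, let $H_f(x)=H(x,f(x),f'(x),\ldots,f^{(n-1)}(x))$ be a method of Class I of order $n$, and let $f$ be a function of class $\mathcal{C}^n$ with a simple zero at $s$. Then the iterative method $H_f$ converges to $s$ with order at least $n$.
   Context: A simple zero $s$ of $f$ satisfies $f(s)=0$ and $f'(s)\ne0$. Class I methods: for $n\ge2$ let $\Pi_n=\{(x_0,x_1,\ldots,x_n)\in\mathbb{R}^{n+1}: x_2\neq0\}$ and $\Gamma_n=\{(x_0,x_1,\ldots,x_n)\in\Pi_n: x_1=0\}$. A Class I method of order $n$ (to approximate simple zeros of real functions) is a pair $(H,\mathcal{W}_H)$ where $\mathcal{W}_H$ is an open neighborhood of $\Gamma_n$ in $\Pi_n$ and $H:\mathcal{W}_H\to\mathbb{R}$ is a $\mathcal{C}^n$ function such that: (a) $H(x_0,0,x_2,\ldots,x_n)=x_0$ for all $(x_0,0,x_2,\ldots,x_n)\in\Gamma_n$; (b) for any real $\mathcal{C}^{2n-2}$ function $\varphi$, the map $H_\varphi(x)=H(x,\varphi(x),\varphi'(x),\ldots,\varphi^{(n-1)}(x))$, which is well defined in a neighborhood of any simple zero $\sigma$ of $\varphi$, satisfies $H_\varphi^{(i)}(\sigma)=0$ for every $i\in\{1,\ldots,n-1\}$; (c) if $(x_0,x_1,x_2,\ldots,x_n)\in\mathcal{W}_H$ then $(x_0,tx_1,x_2,\ldots,x_n)\in\mathcal{W}_H$ for all $t\in[0,1]$. Order: the iterative method given by a map $h$ converges to $s$ with order at least $p>1$ if for any $x_0$ close enough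 to $s$ the sequence $x_{m+1}=h(x_m)$ satisfies $\lim_{m\to\infty}x_m=s$ and the limit $\lim_{m\to\infty}\frac{|x_{m+1}-s|}{|x_m-s|^p}=K\ge0$ exists (considered for sequences with $x_m\neq s$ for all $m$). *)

theory Defs
  imports "HOL-Analysis.Analysis"
begin

text \<open>
  Functions of class \<open>C\<^sup>k\<close> on an open set \<open>S\<close>: all iterated directional derivatives up to
  order \<open>k\<close> exist and are continuous. On an open set this depends only on the values of \<open>f\<close> on
  that set.
\<close>

fun C_k_on :: "nat \<Rightarrow> ('a::euclidean_space \<Rightarrow> 'b::real_normed_vector) \<Rightarrow> 'a set \<Rightarrow> bool" where
  "C_k_on 0 f S \<longleftrightarrow> continuous_on S f"
| "C_k_on (Suc k) f S \<longleftrightarrow>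
     (\<forall>x\<in>S. f differentiable (at x)) \<and>
     (\<forall>v. C_k_on k (\<lambda>x. frechet_derivative f (at x) v) S)"

definition simple_zero :: "(real \<Rightarrow> real) \<Rightarrow> real \<Rightarrow> bool" where
  "simple_zero f s \<longleftrightarrow> f s = 0 \<and> deriv f s \<noteq> 0"

text \<open>
  The space \<open>\<real>\<^bsup>n+1\<^esup>\<close> with coordinates \<open>x\<^sub>0, \<dots>, x\<^sub>n\<close> is rendered as \<open>real ^ 'm\<close> together with an
  enumeration \<open>idx\<close> of the index type, i.e. \<open>bij_betw idx {..n} UNIV\<close>; the coordinate \<open>x\<^sub>i\<close> is
  \<open>x $ idx i\<close>.
\<close>

definition Pi_set :: "(nat \<Rightarrow> 'm::finite) \<Rightarrow> (real ^ 'm) set" where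
  "Pi_set idx = {x. x $ idx 2 \<noteq> 0}"

definition Gamma_set :: "(nat \<Rightarrow> 'm::finite) \<Rightarrow> (real ^ 'm) set" where
  "Gamma_set idx = {x \<in> Pi_set idx. x $ idx 1 = 0}"

definition vec_of :: "(nat \<Rightarrow> 'm::finite) \<Rightarrow> nat \<Rightarrow> (nat \<Rightarrow> real) \<Rightarrow> real ^ 'm" where
  "vec_of idx n a = (\<chi> j. a (the_inv_into {..n} idx j))"

lemma vec_of_nth:
  assumes "bij_betw idx {..n} UNIV" and "i \<le> n"
  shows "vec_of idx n a $ idx i = a i"
  using assms by (simp add: vec_of_def bij_betw_def the_inv_into_f_f)

text \<open>The point \<open>(x, f x, f' x, \<dots>, f\<^sup>(\<^sup>n\<^sup>-\<^sup>1\<^sup>) x)\<close>.\<close>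

definition jet :: "(nat \<Rightarrow> 'm::finite) \<Rightarrow> nat \<Rightarrow> (real \<Rightarrow> real) \<Rightarrow> real \<Rightarrow> real ^ 'm" where
  "jet idx n f x = vec_of idx n (\<lambda>i. case i of 0 \<Rightarrow> x | Suc k \<Rightarrow> (deriv ^^ k) f x)"

definition method_map ::
    "(nat \<Rightarrow> 'm::finite) \<Rightarrow> nat \<Rightarrow> (real ^ 'm \<Rightarrow> real) \<Rightarrow> (real \<Rightarrow> real) \<Rightarrow> real \<Rightarrow> real" where
  "method_map idx n H f x = H (jet idx n f x)"

text \<open>The domain of the preceding map, for \<open>f\<close> defined on \<open>U\<close> and \<open>H\<close> defined on \<open>W\<close>.\<close>

definition method_dom ::
    "(nat \<Rightarrow> 'm::finite) \<Rightarrow> nat \<Rightarrow> (real ^ 'm) set \<Rightarrow> (real \<Rightarrow> real) \<Rightarrow> real set \<Rightarrow> real set" where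
  "method_dom idx n W f U = {x \<in> U. jet idx n f x \<in> W}"

text \<open>
  In the second to last clause, \<open>\<phi>\<close> is a function of class \<open>C\<^bsup>2n-2\<^esup>\<close> on an open set \<open>U\<close>, and
  \<open>method_map idx n H \<phi>\<close> is of class \<open>C\<^bsup>n-1\<^esup>\<close> near \<open>\<sigma>\<close>, so that its iterated \<open>deriv\<close> at \<open>\<sigma>\<close> are
  genuine derivatives.
\<close>

definition class_I_method ::
    "(nat \<Rightarrow> 'm::finite) \<Rightarrow> nat \<Rightarrow> (real ^ 'm \<Rightarrow> real) \<Rightarrow> (real ^ 'm) set \<Rightarrow> bool" where
  "class_I_method idx n H W \<longleftrightarrow>
     openin (top_of_set (Pi_set idx)) W \<and> Gamma_set idx \<subseteq> W \<and>
     C_k_on n H W \<and>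
     (\<forall>x \<in> Gamma_set idx. H x = x $ idx 0) \<and>
     (\<forall>\<phi> U \<sigma>. open U \<longrightarrow> C_k_on (2 * n - 2) \<phi> U \<longrightarrow> \<sigma> \<in> U \<longrightarrow> simple_zero \<phi> \<sigma> \<longrightarrow>
        (\<forall>i \<in> {1..n - 1}. (deriv ^^ i) (method_map idx n H \<phi>) \<sigma> = 0)) \<and>
     (\<forall>x \<in> W. \<forall>t \<in> {0..1}. (\<chi> j. if j = idx 1 then t * x $ j else x $ j) \<in> W)"

text \<open>
  \<open>D\<close> is the domain of \<open>h\<close>; the iterates must be well defined, i.e. remain in \<open>D\<close>.
\<close>

definition converges_with_order_at_least ::
    "(real \<Rightarrow> real) \<Rightarrow> real set \<Rightarrow> real \<Rightarrow> real \<Rightarrow> bool" where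
  "converges_with_order_at_least h D s p \<longleftrightarrow>
     p > 1 \<and>
     (\<exists>\<delta>>0. \<forall>x0. \<bar>x0 - s\<bar> < \<delta> \<longrightarrow>
        (\<forall>m. (h ^^ m) x0 \<in> D) \<and>
        (\<lambda>m. (h ^^ m) x0) \<longlonglongrightarrow> s \<and>
        ((\<forall>m. (h ^^ m) x0 \<noteq> s) \<longrightarrow>
           (\<exists>K\<ge>0. (\<lambda>m. \<bar>(h ^^ Suc m) x0 - s\<bar> / \<bar>(h ^^ m) x0 - s\<bar> powr p) \<longlonglongrightarrow> K)))"

end

theory Submission
  imports Defs
begin

text \<open>
  Fix \<open>x\<close> near \<open>s\<close>. Taylor's theorem gives \<open>\<eta>\<close> between \<open>x\<close> and \<open>s\<close> such that the polynomial
  \<open>\<phi>\<close> of degree \<open>n\<close> with \<open>\<phi>\<^sup>(\<^sup>k\<^sup>)(x) = f\<^sup>(\<^sup>k\<^sup>)(x)\<close> for \<open>k < n\<close> and \<open>\<phi>\<^sup>(\<^sup>n\<^sup>) = f\<^sup>(\<^sup>n\<^sup>)(\<eta>)\<close> vanishes at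
  \<open>s\<close>. Since \<open>\<phi>\<close> and \<open>f\<close> have the same \<open>(n-1)\<close>-jet at \<open>x\<close>, one has \<open>H\<^sub>f(x) = H\<^sub>\<phi>(x)\<close>, and
  condition (b) applied to \<open>\<phi>\<close> gives \<open>H\<^sub>\<phi>(x) - s = H\<^sub>\<phi>\<^sup>(\<^sup>n\<^sup>)(\<xi>) (x - s)\<^sup>n / n!\<close>. The curve
  \<open>t \<mapsto> (t, \<phi>(t), \<dots>, \<phi>\<^sup>(\<^sup>n\<^sup>)(t))\<close> is an integral curve of a vector field that does not depend on
  \<open>\<phi>\<close>, so \<open>H\<^sub>\<phi>\<^sup>(\<^sup>n\<^sup>)(\<xi>)\<close> is the value at a point of this curve of a fixed continuous function, and it
  converges as \<open>x\<close> tends to \<open>s\<close>.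
\<close>

section \<open>Functions of class \<open>C\<^sup>k\<close>\<close>

text \<open>Openness of \<open>S\<close> makes the two functions agree near each of its points, so
  their derivatives agree on \<open>S\<close> too and the induction goes through.\<close>

lemma C_k_on_cong:
  assumes "open S" "\<And>x. x \<in> S \<Longrightarrow> f x = g x" "C_k_on k f S"
  shows "C_k_on k g S"
  using assms(2,3)
proof (induction k arbitrary: f g)
  case 0
  then show ?case by (simp cong: continuous_on_cong)
next
  case (Suc k)
  have D: "(g has_derivative frechet_derivative f (at x)) (at x)" if "x \<in> S" for x
  proof (rule has_derivative_transform_within_open[OF _ assms(1) that Suc.prems(1)])
    show "(f has_derivative frechet_derivative f (at x)) (at x)"
      using Suc.prems(2) that by (simp add: frechet_derivative_works[symmetric])
  qed
  then have E: "frechet_derivative f (at x) = frechet_derivative g (at x)" if "x \<in> S" for x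
    using that by (intro frechet_derivative_at) auto
  have "C_k_on k (\<lambda>x. frechet_derivative g (at x) v) S" for v
    by (rule Suc.IH[of "\<lambda>x. frechet_derivative f (at x) v"]) (use Suc.prems E in auto)
  moreover have "\<forall>x\<in>S. g differentiable (at x)"
    using D differentiable_def by blast
  ultimately show ?case by simp
qed

text \<open>Lets an explicit derivative \<open>D\<close> stand in for
  \<open>frechet_derivative\<close>: derivatives are unique, and \<open>C_k_on_cong\<close> carries
  the regularity across the equality.\<close>

lemma C_k_on_SucI:
  assumes "open S" "\<And>x. x \<in> S \<Longrightarrow> (f has_derivative D x) (at x)"
    and "\<And>v. C_k_on k (\<lambda>x. D x v) S"
  shows "C_k_on (Suc k) f S"
proof -
  have "C_k_on k (\<lambda>x. frechet_derivative f (at x) v) S" for v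
    by (rule C_k_on_cong[OF assms(1) _ assms(3)[of v]])
       (metis assms(2) frechet_derivative_at)
  then show ?thesis using assms(2) by (auto simp: differentiable_def)
qed

lemma C_k_on_Suc_has_derivative:
  assumes "C_k_on (Suc k) f S" "x \<in> S"
  shows "(f has_derivative frechet_derivative f (at x)) (at x)"
  using assms by (simp add: frechet_derivative_works[symmetric])

lemma C_k_on_SucD: "C_k_on (Suc k) f S \<Longrightarrow> C_k_on k f S"
proof (induction k arbitrary: f)
  case 0
  then show ?case
    by (auto intro!: continuous_at_imp_continuous_on differentiable_imp_continuous_within)
next
  case (Suc k)
  have "C_k_on k (\<lambda>x. frechet_derivative f (at x) v) S" for v
    using Suc.prems unfolding C_k_on.simps(2)[of "Suc k"] by (intro Suc.IH) blast
  moreover have "\<forall>x\<in>S. f differentiable (at x)"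
    using Suc.prems unfolding C_k_on.simps(2)[of "Suc k"] by blast
  ultimately show ?case by simp
qed

lemma C_k_on_imp_continuous_on: "C_k_on k f S \<Longrightarrow> continuous_on S f"
  by (induction k) (simp, blast dest: C_k_on_SucD)

lemma C_k_on_const: "open S \<Longrightarrow> C_k_on k (\<lambda>_. c) S"
  by (induction k arbitrary: c) (auto intro!: C_k_on_SucI[where D = "\<lambda>_ _. 0"] simp del: C_k_on.simps(2))

lemma C_k_on_bounded_linear:
  assumes "open S" "bounded_linear f"
  shows "C_k_on k f S"
proof (cases k)
  case 0
  then show ?thesis using assms by (simp add: linear_continuous_on)
next
  case (Suc m)
  then show ?thesis
    using assms by (auto intro!: C_k_on_SucI C_k_on_const bounded_linear_imp_has_derivative
        simp del: C_k_on.simps)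
qed

lemma C_k_on_add:
  assumes "open S" "C_k_on k f S" "C_k_on k g S"
  shows "C_k_on k (\<lambda>x. f x + g x) S"
  using assms(2,3)
proof (induction k arbitrary: f g)
  case 0
  then show ?case by (simp add: continuous_on_add)
next
  case (Suc k)
  show ?case
  proof (rule C_k_on_SucI[OF assms(1)])
    show "((\<lambda>x. f x + g x) has_derivative
        (\<lambda>v. frechet_derivative f (at x) v + frechet_derivative g (at x) v)) (at x)" if "x \<in> S" for x
      using Suc.prems that by (intro has_derivative_add C_k_on_Suc_has_derivative)
    show "C_k_on k (\<lambda>x. frechet_derivative f (at x) v + frechet_derivative g (at x) v) S" for v
      using Suc.prems by (intro Suc.IH) auto
  qed
qed

lemma C_k_on_mult:
  fixes f g :: "'a::euclidean_space \<Rightarrow> real"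
  assumes "open S" "C_k_on k f S" "C_k_on k g S"
  shows "C_k_on k (\<lambda>x. f x * g x) S"
  using assms(2,3)
proof (induction k arbitrary: f g)
  case 0
  then show ?case by (simp add: continuous_on_mult)
next
  case (Suc k)
  show ?case
  proof (rule C_k_on_SucI[OF assms(1)])
    show "((\<lambda>x. f x * g x) has_derivative
        (\<lambda>v. f x * frechet_derivative g (at x) v + frechet_derivative f (at x) v * g x)) (at x)"
      if "x \<in> S" for x
      using Suc.prems that by (intro has_derivative_mult C_k_on_Suc_has_derivative)
    show "C_k_on k (\<lambda>x. f x * frechet_derivative g (at x) v + frechet_derivative f (at x) v * g x) S"
      for v
      using Suc.prems C_k_on_SucD[OF Suc.prems(1)] C_k_on_SucD[OF Suc.prems(2)]
      by (intro C_k_on_add Suc.IH assms(1)) auto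
  qed
qed

lemma C_k_on_sum:
  assumes "open S" "\<And>i. i \<in> I \<Longrightarrow> C_k_on k (f i) S"
  shows "C_k_on k (\<lambda>x. \<Sum>i\<in>I. f i x) S"
  using assms(2)
  by (induction I rule: infinite_finite_induct)
     (auto intro!: C_k_on_const C_k_on_add assms(1))

text \<open>Serves to regard \<open>H\<close> as a function of the enlarged point
  \<open>(x, b)\<close> that is constant in \<open>b\<close>; the coordinate \<open>b\<close> enters
  once derivatives along curves are taken.\<close>

lemma C_k_on_fst:
  assumes "open S" "C_k_on k f S"
  shows "C_k_on k (\<lambda>y. f (fst y)) (S \<times> (UNIV :: 'c::euclidean_space set))"
  using assms(2)
proof (induction k arbitrary: f)
  case 0
  then show ?case
    by (auto intro!: continuous_on_compose2[of S f] continuous_intros)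
next
  case (Suc k)
  have "((\<lambda>y. f (fst y)) has_derivative (\<lambda>v. frechet_derivative f (at (fst x)) (fst v))) (at x)"
    if "x \<in> S \<times> (UNIV :: 'c set)" for x
    using C_k_on_Suc_has_derivative[OF Suc.prems, of "fst x"] that
    by (intro has_derivative_compose[where f = fst and g = f]) (auto intro!: derivative_eq_intros)
  moreover have "C_k_on k (\<lambda>x. frechet_derivative f (at (fst x)) (fst v))
      (S \<times> (UNIV :: 'c set))" for v
    using Suc.prems Suc.IH[of "\<lambda>x. frechet_derivative f (at x) (fst v)"] by simp
  ultimately show ?case
    by (intro C_k_on_SucI[where D = "\<lambda>x v. frechet_derivative f (at (fst x)) (fst v)"]
        open_Times assms(1)) auto
qed

section \<open>Iterated derivatives and Taylor's formula on the real line\<close>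

lemma funpow_deriv_eq:
  fixes g :: "nat \<Rightarrow> real \<Rightarrow> real"
  assumes "open S"
    and "\<And>k t. k < m \<Longrightarrow> t \<in> S \<Longrightarrow> (g k has_real_derivative g (Suc k) t) (at t)"
    and "k \<le> m" "t \<in> S"
  shows "(deriv ^^ k) (g 0) t = g k t"
  using assms(3,4)
proof (induction k arbitrary: t)
  case (Suc k)
  \<comment> \<open>The induction hypothesis is used on a whole neighbourhood of \<open>t\<close>,
    since its value at \<open>t\<close> alone does not determine \<open>deriv\<close> there.\<close>
  have "eventually (\<lambda>u. (deriv ^^ k) (g 0) u = g k u) (nhds t)"
    using Suc assms(1) by (auto simp: eventually_nhds)
  then have "deriv ((deriv ^^ k) (g 0)) t = deriv (g k) t"
    by (intro deriv_cong_ev) auto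
  also have "\<dots> = g (Suc k) t"
    using Suc.prems by (intro DERIV_imp_deriv assms(2)) auto
  finally show ?case by simp
qed simp

lemma C_k_on_derivs:
  fixes g :: "nat \<Rightarrow> real \<Rightarrow> real"
  assumes "open S" "\<And>k t. t \<in> S \<Longrightarrow> (g k has_real_derivative g (Suc k) t) (at t)"
  shows "C_k_on m (g k) S"
proof (induction m arbitrary: k)
  case 0
  then show ?case
    using assms(2) by (auto intro!: continuous_at_imp_continuous_on DERIV_isCont)
next
  case (Suc m)
  show ?case
    using assms(2)[of _ k]
    by (intro C_k_on_SucI[where D = "\<lambda>x v. g (Suc k) x * v"] C_k_on_mult C_k_on_const Suc assms(1))
       (auto simp: has_field_derivative_def)
qed

text \<open>In dimension one the directional derivative in direction 1 is \<open>deriv f\<close>.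
  The induction peels off the innermost \<open>deriv\<close>, so it has to vary
  \<open>f\<close>.\<close>

lemma C_k_on_real_derivs:
  fixes f :: "real \<Rightarrow> real"
  assumes "open S" "C_k_on n f S"
  shows "k < n \<Longrightarrow> x \<in> S \<Longrightarrow> ((deriv ^^ k) f has_real_derivative (deriv ^^ Suc k) f x) (at x)"
    and "k \<le> n \<Longrightarrow> continuous_on S ((deriv ^^ k) f)"
proof -
  have "(k < n \<longrightarrow> (\<forall>x\<in>S. ((deriv ^^ k) f has_real_derivative (deriv ^^ Suc k) f x) (at x))) \<and>
        (k \<le> n \<longrightarrow> continuous_on S ((deriv ^^ k) f))" for k
    using assms(2)
  proof (induction n arbitrary: k f)
    case 0
    then show ?case by simp
  next
    case (Suc n)
    have D: "(f has_real_derivative deriv f x) (at x)"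
      and E: "frechet_derivative f (at x) 1 = deriv f x" if "x \<in> S" for x
    proof -
      have "f field_differentiable at x"
        using Suc.prems that by (auto simp: field_differentiable_def real_differentiable_def)
      then show D: "(f has_real_derivative deriv f x) (at x)"
        by (rule DERIV_deriv_iff_field_differentiable[THEN iffD2])
      then show "frechet_derivative f (at x) 1 = deriv f x"
        by (metis frechet_derivative_at has_field_derivative_def mult.right_neutral)
    qed
    have "C_k_on n (deriv f) S"
      by (rule C_k_on_cong[of S "\<lambda>x. frechet_derivative f (at x) 1"]) (use Suc.prems E assms(1) in auto)
    note IH = Suc.IH[OF this]
    have shift: "(deriv ^^ Suc j) f = (deriv ^^ j) (deriv f)" for j
      by (simp only: funpow_Suc_right o_apply)
    show ?case
    proof (cases k)
      case 0
      then show ?thesis using C_k_on_imp_continuous_on[OF Suc.prems] D by simp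
    next
      case (Suc m)
      show ?thesis using IH[of m] unfolding Suc shift by simp
    qed
  qed
  then show "k < n \<Longrightarrow> x \<in> S \<Longrightarrow> ((deriv ^^ k) f has_real_derivative (deriv ^^ Suc k) f x) (at x)"
    and "k \<le> n \<Longrightarrow> continuous_on S ((deriv ^^ k) f)" by blast+
qed

text \<open>The two distance conditions together describe the segment between \<open>c\<close> and
  \<open>x\<close> in either order, so no later use has to distinguish \<open>x < c\<close> from
  \<open>c < x\<close>.\<close>

lemma Taylor_between:
  fixes g :: "nat \<Rightarrow> real \<Rightarrow> real"
  assumes "0 < n" "x \<noteq> c"
    and "\<And>m t. m < n \<Longrightarrow> \<bar>t - c\<bar> \<le> \<bar>x - c\<bar> \<Longrightarrow> \<bar>t - x\<bar> \<le> \<bar>x - c\<bar> \<Longrightarrow>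
      (g m has_real_derivative g (Suc m) t) (at t)"
  obtains t where "\<bar>t - c\<bar> < \<bar>x - c\<bar>" "\<bar>t - x\<bar> < \<bar>x - c\<bar>"
    and "g 0 x = (\<Sum>m<n. g m c / fact m * (x - c) ^ m) + g n t / fact n * (x - c) ^ n"
proof -
  have "\<exists>t. (if x < c then x < t \<and> t < c else c < t \<and> t < x) \<and>
      g 0 x = (\<Sum>m<n. g m c / fact m * (x - c) ^ m) + g n t / fact n * (x - c) ^ n"
    by (rule Taylor[where a = "min x c" and b = "max x c"]) (use assms in auto)
  then obtain t where t: "if x < c then x < t \<and> t < c else c < t \<and> t < x"
    and eq: "g 0 x = (\<Sum>m<n. g m c / fact m * (x - c) ^ m) + g n t / fact n * (x - c) ^ n"
    by blast
  have "\<bar>t - c\<bar> < \<bar>x - c\<bar>" "\<bar>t - x\<bar> < \<bar>x - c\<bar>"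
    using t by (auto split: if_splits)
  then show thesis using eq by (rule that)
qed

section \<open>Polynomials with prescribed derivatives\<close>

text \<open>The \<open>k\<close>-th derivative of the polynomial whose derivatives at 0 are
  \<open>c 0\<close>, ..., \<open>c n\<close>. Truncated subtraction empties the sum for
  \<open>k > n\<close>, so the differentiation rule holds for every \<open>k\<close>.\<close>

definition taylor_poly :: "nat \<Rightarrow> (nat \<Rightarrow> real) \<Rightarrow> nat \<Rightarrow> real \<Rightarrow> real" where
  "taylor_poly n c k t = (\<Sum>j<Suc n - k. c (k + j) / fact j * t ^ j)"

lemma taylor_poly_at_0: "k \<le> n \<Longrightarrow> taylor_poly n c k 0 = c k"
  unfolding taylor_poly_def Suc_diff_le by (subst sum.lessThan_Suc_shift) simp

lemma taylor_poly_top: "taylor_poly n c n t = c n"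
  by (simp add: taylor_poly_def)

lemma has_real_derivative_taylor_poly:
  "(taylor_poly n c k has_real_derivative taylor_poly n c (Suc k) t) (at t)"
proof (cases "k \<le> n")
  case True
  have "((\<lambda>t. \<Sum>j<Suc (n - k). c (k + j) / fact j * t ^ j) has_real_derivative
      (\<Sum>j<Suc (n - k). c (k + j) / fact j * (real j * t ^ (j - 1)))) (at t)"
    by (intro DERIV_sum) (auto intro!: derivative_eq_intros)
  also have "(\<Sum>j<Suc (n - k). c (k + j) / fact j * (real j * t ^ (j - 1))) =
      (\<Sum>j<n - k. c (Suc k + j) / fact j * t ^ j)"
    by (subst sum.lessThan_Suc_shift) (auto intro!: sum.cong simp: divide_simps)
  finally show ?thesis
    using True by (simp add: taylor_poly_def[abs_def] Suc_diff_le)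
qed (simp add: taylor_poly_def[abs_def])

section \<open>Jets of curves\<close>

lemma vec_of_cong:
  assumes "bij_betw idx {..n} (UNIV :: 'm::finite set)" "\<And>i. i \<le> n \<Longrightarrow> a i = b i"
  shows "vec_of idx n a = vec_of idx n b"
proof -
  have "the_inv_into {..n} idx j \<le> n" for j
    using assms(1) by (metis UNIV_I atMost_iff bij_betw_def the_inv_into_into order_refl)
  then show ?thesis using assms(2) by (simp add: vec_of_def)
qed

lemma vec_of_eq_sum:
  assumes "bij_betw idx {..n} (UNIV :: 'm::finite set)"
  shows "vec_of idx n a = (\<Sum>i\<le>n. a i *\<^sub>R axis (idx i) 1)"
proof (rule vec_eq_iff[THEN iffD2], rule allI)
  fix j
  obtain l where l: "l \<le> n" "j = idx l"
    using assms by (metis UNIV_I atMost_iff bij_betw_def imageE)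
  have inj: "idx l = idx i \<longleftrightarrow> i = l" if "i \<le> n" for i
    using assms l(1) that by (auto simp: bij_betw_def inj_on_def)
  have "(\<Sum>i\<le>n. (a i *\<^sub>R axis (idx i) 1) $ j) = (\<Sum>i\<le>n. if i = l then a i else 0)"
    unfolding l(2) by (intro sum.cong) (simp_all add: axis_def inj)
  then show "vec_of idx n a $ j = (\<Sum>i\<le>n. a i *\<^sub>R axis (idx i) 1) $ j"
    using l vec_of_nth[OF assms l(1)] by (simp add: sum_component)
qed

text \<open>The family \<open>g\<close> stands for successive derivatives. As in \<open>jet\<close>,
  coordinate \<open>i > 0\<close> holds order \<open>i - 1\<close>, so the vector stops at order
  \<open>n - 1\<close> and order \<open>n\<close> goes into the extra component.\<close>

definition ext_jet :: "(nat \<Rightarrow> 'm::finite) \<Rightarrow> nat \<Rightarrow> (nat \<Rightarrow> real \<Rightarrow> real) \<Rightarrow> real \<Rightarrow> (real ^ 'm) \<times> real" where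
  "ext_jet idx n g t = (vec_of idx n (case_nat t (\<lambda>k. g k t)), g n t)"

text \<open>
  The derivative along the vector field \<open>(1, x\<^sub>2, \<dots>, x\<^sub>n, b)\<close> on the points \<open>(x\<^sub>0, \<dots>, x\<^sub>n, b)\<close>, whose
  integral curves are the extended jets of the polynomials of degree at most \<open>n\<close>. The additional
  coordinate \<open>b\<close> makes the continuity in the leading coefficient available.
\<close>

definition flow_deriv ::
    "(nat \<Rightarrow> 'm::finite) \<Rightarrow> nat \<Rightarrow> ((real ^ 'm) \<times> real \<Rightarrow> real) \<Rightarrow> (real ^ 'm) \<times> real \<Rightarrow> real" where
  "flow_deriv idx n K y =
     (\<Sum>i\<le>n. (if i = 0 then 1 else if i < n then fst y $ idx (Suc i) else snd y) *
        frechet_derivative K (at y) (axis (idx i) 1, 0))"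

lemma C_k_on_flow_deriv:
  assumes "open S" "C_k_on (Suc k) K S"
  shows "C_k_on k (flow_deriv idx n K) S"
  unfolding flow_deriv_def[abs_def]
proof (intro C_k_on_sum C_k_on_mult assms(1))
  fix i
  have "bounded_linear (\<lambda>y :: (real ^ 'a) \<times> real. fst y $ idx (Suc i))"
    by (rule bounded_linear_compose[OF bounded_linear_vec_nth bounded_linear_fst])
  then show "C_k_on k (\<lambda>y :: (real ^ 'a) \<times> real.
      if i = 0 then 1 else if i < n then fst y $ idx (Suc i) else snd y) S"
    using assms(1)
    by (cases "i = 0"; cases "i < n") (auto intro: C_k_on_const C_k_on_bounded_linear bounded_linear_snd)
  show "C_k_on k (\<lambda>y. frechet_derivative K (at y) (axis (idx i) 1, 0)) S"
    using assms(2) by simp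
qed

lemma C_k_on_funpow_flow_deriv:
  assumes "open S" "C_k_on (j + k) K S"
  shows "C_k_on k ((flow_deriv idx n ^^ j) K) S"
  using assms(2) by (induction j arbitrary: k) (auto intro!: C_k_on_flow_deriv assms(1) simp del: C_k_on.simps)

text \<open>Chain rule along a curve whose velocity is the vector field at its current point.
  Constancy of \<open>g n\<close> gives velocity 0 in the extra coordinate, where the field has
  component 0.\<close>

lemma has_real_derivative_flow_deriv:
  assumes idx: "bij_betw idx {..n} (UNIV :: 'm::finite set)" and "n \<ge> 1"
    and g: "\<And>k. k < n \<Longrightarrow> (g k has_real_derivative g (Suc k) t) (at t)"
    and const: "(g n has_real_derivative 0) (at t)"
    and K: "K differentiable (at (ext_jet idx n g t))"
  shows "((\<lambda>t. K (ext_jet idx n g t)) has_real_derivative flow_deriv idx n K (ext_jet idx n g t)) (at t)"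
proof -
  define y where "y = ext_jet idx n g t"
  define c where "c i = (if i = 0 then 1 else if i < n then fst y $ idx (Suc i) else snd y)" for i
  define D where "D = frechet_derivative K (at y)"
  \<comment> \<open>The velocity of coordinate \<open>Suc k\<close> is read off from the next
    coordinate; for the last one, \<open>Suc k = n\<close>, it is the extra component.\<close>
  have cS: "c (Suc k) = g (Suc k) t" if "k < n" for k
    using that vec_of_nth[OF idx, of "Suc (Suc k)"] by (auto simp: c_def y_def ext_jet_def
        less_Suc_eq not_less_eq intro!: arg_cong[where f = "\<lambda>i. g i t"])
  have "((\<lambda>t. case_nat t (\<lambda>k. g k t) i) has_vector_derivative c i) (at t)" if "i \<le> n" for i
    using that g[of "i - 1"] cS[of "i - 1"]
    by (cases i) (auto simp: c_def has_real_derivative_iff_has_vector_derivative[symmetric])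
  then have "((\<lambda>t. \<Sum>i\<le>n. case_nat t (\<lambda>k. g k t) i *\<^sub>R axis (idx i) (1::real)) has_vector_derivative
      (\<Sum>i\<le>n. c i *\<^sub>R axis (idx i) 1)) (at t)"
    by (intro has_vector_derivative_sum
        bounded_linear.has_vector_derivative[OF bounded_linear_scaleR_left]) auto
  then have "(ext_jet idx n g has_vector_derivative (\<Sum>i\<le>n. c i *\<^sub>R axis (idx i) 1, 0)) (at t)"
    using const unfolding ext_jet_def[abs_def] vec_of_eq_sum[OF idx]
    by (intro has_vector_derivative_Pair) (auto simp: has_real_derivative_iff_has_vector_derivative)
  moreover have KD: "(K has_derivative D) (at y)"
    using K unfolding D_def y_def by (rule frechet_derivative_works[THEN iffD1])
  ultimately have "((K \<circ> ext_jet idx n g) has_vector_derivative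
      D (\<Sum>i\<le>n. c i *\<^sub>R axis (idx i) 1, 0)) (at t)"
    by (intro vector_derivative_diff_chain_within) (auto simp: y_def intro: has_derivative_at_withinI)
  moreover have "(\<Sum>i\<le>n. c i *\<^sub>R axis (idx i) (1::real), 0::real) =
      (\<Sum>i\<le>n. c i *\<^sub>R (axis (idx i) 1, 0))"
    by (simp add: prod_eq_iff fst_sum snd_sum)
  moreover have "D (\<Sum>i\<le>n. c i *\<^sub>R (axis (idx i) 1, 0)) = (\<Sum>i\<le>n. c i * D (axis (idx i) 1, 0))"
    by (simp only: linear_sum[OF has_derivative_linear[OF KD]]
        linear_cmul[OF has_derivative_linear[OF KD]] real_scaleR_def)
  moreover have "\<dots> = flow_deriv idx n K y"
    by (simp add: flow_deriv_def c_def D_def)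
  ultimately show ?thesis
    by (simp add: has_real_derivative_iff_has_vector_derivative o_def y_def)
qed

section \<open>Order of convergence\<close>

text \<open>A finite limit bounds the quotient near \<open>s\<close>, and since
  \<open>n \<ge> 2\<close> this makes \<open>h\<close> halve the distance to \<open>s\<close>. The
  iterates therefore converge, and composing the limit with them gives the constant
  \<open>\<bar>C\<bar>\<close>.\<close>

lemma converges_with_order_at_leastI:
  fixes h :: "real \<Rightarrow> real"
  assumes "n \<ge> 2" "h s = s" "eventually (\<lambda>x. x \<in> D) (nhds s)"
    and lim: "((\<lambda>x. (h x - s) / (x - s) ^ n) \<longlongrightarrow> C) (at s)"
  shows "converges_with_order_at_least h D s (real n)"
proof -
  \<comment> \<open>Strictly larger than the limit \<open>\<bar>C\<bar>\<close>, hence an eventual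
    bound for the quotient.\<close>
  define M where "M = \<bar>C\<bar> + 1"
  have "M > 0" by (simp add: M_def)
  obtain d1 where d1: "d1 > 0" "\<And>x. \<bar>x - s\<bar> < d1 \<Longrightarrow> x \<in> D"
    using assms(3) by (auto simp: eventually_nhds_metric dist_real_def)
  have "eventually (\<lambda>x. \<bar>(h x - s) / (x - s) ^ n\<bar> < M) (at s)"
    by (rule order_tendstoD(2)[OF tendsto_rabs[OF lim]]) (simp add: M_def)
  then obtain d2 where d2: "d2 > 0"
    "\<And>x. x \<noteq> s \<Longrightarrow> \<bar>x - s\<bar> < d2 \<Longrightarrow> \<bar>(h x - s) / (x - s) ^ n\<bar> < M"
    by (auto simp: eventually_at dist_real_def)
  \<comment> \<open>The bound 1 allows the exponent \<open>n\<close> to be lowered to 2; the bound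
    \<open>1 / (2 * M)\<close> turns one of the two remaining factors into the ratio 1/2.\<close>
  define d where "d = min (min d1 d2) (min 1 (1 / (2 * M)))"
  have d: "d > 0" "d \<le> d1" "d \<le> d2" "d \<le> 1" "d \<le> 1 / (2 * M)"
    using d1 d2 \<open>M > 0\<close> by (auto simp: d_def)
  have contr: "\<bar>h x - s\<bar> \<le> \<bar>x - s\<bar> / 2" if x: "\<bar>x - s\<bar> < d" for x
  proof (cases "x = s")
    case False
    have "\<bar>h x - s\<bar> \<le> M * \<bar>x - s\<bar> ^ n"
      using d2(2)[of x] x d False by (auto simp: abs_divide power_abs divide_simps)
    also have "\<bar>x - s\<bar> ^ n \<le> \<bar>x - s\<bar> ^ 2"
      using x d assms(1) by (intro power_decreasing) auto
    also have "M * \<bar>x - s\<bar> ^ 2 = (M * \<bar>x - s\<bar>) * \<bar>x - s\<bar>"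
      by (simp add: power2_eq_square)
    also have "\<dots> \<le> 1 / 2 * \<bar>x - s\<bar>"
    proof (rule mult_right_mono)
      have "M * \<bar>x - s\<bar> \<le> M * (1 / (2 * M))"
        using x d \<open>M > 0\<close> by (intro mult_left_mono) auto
      then show "M * \<bar>x - s\<bar> \<le> 1 / 2" using \<open>M > 0\<close> by simp
    qed simp
    finally show ?thesis using \<open>M > 0\<close> by simp
  qed (simp add: assms(2))
  show ?thesis
    unfolding converges_with_order_at_least_def
  proof (rule conjI, use assms(1) in simp, rule exI[of _ d], intro conjI allI impI d(1))
    fix x0 assume x0: "\<bar>x0 - s\<bar> < d"
    \<comment> \<open>The geometric bound is proved together with the bound by \<open>d\<close>,
      because \<open>contr\<close> applies only within distance \<open>d\<close>.\<close>
    have bd: "\<bar>(h ^^ m) x0 - s\<bar> \<le> \<bar>x0 - s\<bar> * (1 / 2) ^ m \<and> \<bar>(h ^^ m) x0 - s\<bar> < d" for m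
    proof (induction m)
      case (Suc m)
      have "\<bar>h ((h ^^ m) x0) - s\<bar> \<le> \<bar>(h ^^ m) x0 - s\<bar> / 2"
        using Suc by (intro contr) simp
      moreover have "u \<le> B / 2 \<and> u < d" if "u \<le> a / 2" "0 \<le> a" "a \<le> B" "a < d" for u a B :: real
        using that by linarith
      ultimately have "\<bar>h ((h ^^ m) x0) - s\<bar> \<le> \<bar>x0 - s\<bar> * (1 / 2) ^ m / 2 \<and>
          \<bar>h ((h ^^ m) x0) - s\<bar> < d" using Suc abs_ge_zero by blast
      then show ?case by simp
    qed (use x0 in simp)
    then show "(h ^^ m) x0 \<in> D" for m
      using d1(2)[of "(h ^^ m) x0"] d(2) by (meson less_le_trans)
    have "(\<lambda>m. \<bar>x0 - s\<bar> * (1 / 2) ^ m) \<longlonglongrightarrow> \<bar>x0 - s\<bar> * 0"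
      by (intro tendsto_mult tendsto_const LIMSEQ_power_zero) auto
    then have "(\<lambda>m. (h ^^ m) x0 - s) \<longlonglongrightarrow> 0"
      by (intro Lim_null_comparison[of "\<lambda>m. (h ^^ m) x0 - s"]) (use bd in auto)
    then show conv: "(\<lambda>m. (h ^^ m) x0) \<longlonglongrightarrow> s"
      by (simp add: LIM_zero_iff)
    assume ne: "\<forall>m. (h ^^ m) x0 \<noteq> s"
    have "filterlim (\<lambda>m. (h ^^ m) x0) (at s) sequentially"
      using conv ne by (auto simp: filterlim_at)
    from tendsto_rabs[OF filterlim_compose[OF lim this]]
    have "(\<lambda>m. \<bar>(h ^^ Suc m) x0 - s\<bar> / \<bar>(h ^^ m) x0 - s\<bar> powr real n) \<longlonglongrightarrow> \<bar>C\<bar>"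
      using ne by (simp add: abs_divide power_abs powr_realpow)
    then show "\<exists>K\<ge>0. (\<lambda>m. \<bar>(h ^^ Suc m) x0 - s\<bar> / \<bar>(h ^^ m) x0 - s\<bar> powr real n) \<longlonglongrightarrow> K"
      by (intro exI[of _ "\<bar>C\<bar>"]) auto
  qed
qed

theorem theorem3:
  fixes idx :: "nat \<Rightarrow> 'm::finite" and n :: nat
    and H :: "real ^ 'm \<Rightarrow> real" and W :: "(real ^ 'm) set"
    and f :: "real \<Rightarrow> real" and U :: "real set" and s :: real
  assumes "n \<ge> 2"
    and "bij_betw idx {..n} (UNIV :: 'm set)"
    and "class_I_method idx n H W"
    and "open U" and "C_k_on n f U"
    and "s \<in> U" and "simple_zero f s"
  shows "converges_with_order_at_least (method_map idx n H f) (method_dom idx n W f U) s (real n)"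
proof -

  \<comment> \<open>Consequences of the Class I conditions\<close>
  note idx = assms(2)
  have open_Pi: "open (Pi_set idx)"
  proof -
    have "Pi_set idx = (\<lambda>x. x $ idx 2) -` (- {0})"
      by (auto simp: Pi_set_def)
    then show ?thesis by (auto intro!: open_vimage continuous_intros)
  qed
  have W: "open W" "W \<subseteq> Pi_set idx"
    using assms(3) open_Pi openin_open_eq[OF open_Pi] by (auto simp: class_I_method_def)
  have \<Gamma>: "Gamma_set idx \<subseteq> W" and H_\<Gamma>: "\<And>x. x \<in> Gamma_set idx \<Longrightarrow> H x = x $ idx 0"
    and C_H: "C_k_on n H W"
    and vanish: "\<And>\<phi> \<sigma> i. C_k_on (2 * n - 2) \<phi> UNIV \<Longrightarrow> simple_zero \<phi> \<sigma> \<Longrightarrow> 1 \<le> i \<Longrightarrow> i < n \<Longrightarrow>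
        (deriv ^^ i) (method_map idx n H \<phi>) \<sigma> = 0"
  proof -
    note cl = assms(3)[unfolded class_I_method_def]
    show "Gamma_set idx \<subseteq> W" "C_k_on n H W" using cl by blast+
    show "H x = x $ idx 0" if "x \<in> Gamma_set idx" for x using cl that by blast
    show "(deriv ^^ i) (method_map idx n H \<phi>) \<sigma> = 0"
      if "C_k_on (2 * n - 2) \<phi> UNIV" "simple_zero \<phi> \<sigma>" "1 \<le> i" "i < n" for \<phi> \<sigma> i
    proof -
      have "i \<in> {1..n - 1}" using that by simp
      then show ?thesis using cl that(1,2) open_UNIV UNIV_I by blast
    qed
  qed
  define F where "F k = (deriv ^^ k) f" for k
  have F_deriv: "(F k has_real_derivative F (Suc k) x) (at x)" if "k < n" "x \<in> U" for k x
    using C_k_on_real_derivs(1)[OF assms(4,5) that] by (simp add: F_def)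
  have F_cont: "isCont (F k) s" if "k \<le> n" for k
    using C_k_on_real_derivs(2)[OF assms(4,5) that] assms(4,6)
    by (simp add: F_def continuous_on_eq_continuous_at)
  have jet_component: "jet idx n \<phi> x $ idx 0 = x" "jet idx n \<phi> x $ idx 1 = \<phi> x"
    "jet idx n \<phi> x $ idx 2 = deriv \<phi> x" for \<phi> x
    using assms(1) vec_of_nth[OF idx, of 0] vec_of_nth[OF idx, of 1] vec_of_nth[OF idx, of 2]
    by (auto simp: jet_def numeral_2_eq_2)
  have \<Gamma>_jet: "jet idx n \<phi> \<sigma> \<in> Gamma_set idx" if "simple_zero \<phi> \<sigma>" for \<phi> \<sigma>
    using that jet_component[of \<phi> \<sigma>] by (simp add: Gamma_set_def Pi_set_def simple_zero_def)
  have fix_zero: "method_map idx n H \<phi> \<sigma> = \<sigma>" if "simple_zero \<phi> \<sigma>" for \<phi> \<sigma>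
    using H_\<Gamma>[OF \<Gamma>_jet[OF that]] jet_component by (simp add: method_map_def)

  \<comment> \<open>Iterated derivatives of the method along the vector field\<close>
  define S where "S = W \<times> (UNIV :: real set)"
  \<comment> \<open>Each application of \<open>flow_deriv\<close> costs one order of
    differentiability, so class \<open>C\<^sup>n\<close> of \<open>H\<close> leaves
    \<open>L n\<close> continuous.\<close>
  define L where "L k = (flow_deriv idx n ^^ k) (\<lambda>y. H (fst y))" for k
  have "open S" unfolding S_def by (intro open_Times W(1) open_UNIV)
  have C_L: "C_k_on (n - k) (L k) S" if "k \<le> n" for k
    unfolding L_def S_def using that W(1) C_H
    by (intro C_k_on_funpow_flow_deriv open_Times C_k_on_fst) auto
  have L_cont: "continuous_on S (L n)" and L_diff: "k < n \<Longrightarrow> y \<in> S \<Longrightarrow> L k differentiable (at y)" for k y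
  proof -
    show "continuous_on S (L n)" using C_L[of n] by simp
    assume "k < n" "y \<in> S"
    then have "C_k_on (Suc (n - Suc k)) (L k) S"
      using C_L[of k] by (simp add: Suc_diff_Suc del: C_k_on.simps)
    then show "L k differentiable (at y)" using \<open>y \<in> S\<close> by simp
  qed

  \<comment> \<open>The approximating polynomials and their jets\<close>
  define c where "c x \<eta> k = (if k < n then F k x else F n \<eta>)" for x \<eta> :: real and k
  \<comment> \<open>The intermediate point \<open>\<eta>\<close> remains a free parameter for now,
    so that continuity can be established jointly in \<open>(x, \<eta>, t)\<close> at
    \<open>(s, s, s)\<close>.\<close>
  define \<Phi> where "\<Phi> x \<eta> k t = taylor_poly n (c x \<eta>) k (t - x)" for x \<eta> k t
  define J where "J = (\<lambda>(x, \<eta>, t). ext_jet idx n (\<Phi> x \<eta>) t)"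
  have \<Phi>_deriv: "(\<Phi> x \<eta> k has_real_derivative \<Phi> x \<eta> (Suc k) t) (at t)" for x \<eta> k t
  proof -
    have "((\<lambda>t. t - x) has_real_derivative 1) (at t)"
      by (auto intro!: derivative_eq_intros)
    from DERIV_chain2[OF has_real_derivative_taylor_poly this] show ?thesis
      by (simp add: \<Phi>_def[abs_def])
  qed
  have \<Phi>_at: "\<Phi> x \<eta> k x = F k x" if "k < n" for x \<eta> k
    using that by (simp add: \<Phi>_def taylor_poly_at_0 c_def)
  have \<Phi>_n: "\<Phi> x \<eta> n t = F n \<eta>" for x \<eta> t
    by (simp add: \<Phi>_def taylor_poly_top c_def)
  have deriv_\<Phi>: "(deriv ^^ k) (\<Phi> x \<eta> 0) t = \<Phi> x \<eta> k t" for x \<eta> k t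
    by (rule funpow_deriv_eq[of UNIV k]) (auto intro: \<Phi>_deriv)
  have jet_\<Phi>: "fst (J (x, \<eta>, t)) = jet idx n (\<Phi> x \<eta> 0) t" for x \<eta> t
    unfolding J_def ext_jet_def jet_def
    by (auto intro!: vec_of_cong[OF idx] simp: deriv_\<Phi> split: nat.split)
  \<comment> \<open>Any \<open>\<eta>\<close> will do: it affects only the derivative of order
    \<open>n\<close>, and the jet stops at order \<open>n - 1\<close>.\<close>
  have jet_f: "jet idx n f x = fst (J (x, \<eta>, x))" for x \<eta>
    unfolding J_def ext_jet_def jet_def
    by (auto intro!: vec_of_cong[OF idx] simp: \<Phi>_at F_def[symmetric] split: nat.split)
  \<comment> \<open>For \<open>k = n\<close> this is the continuity of the \<open>n\<close>-th
    derivative of \<open>f\<close> at \<open>s\<close>.\<close>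
  have c_cont: "isCont (\<lambda>z. c (fst z) (fst (snd z)) k) (s, s, s)" for k
    using isCont_o2[where g = "F k" and f = fst and a = "(s, s, s)"] F_cont[of k]
      isCont_o2[where g = "F n" and f = "\<lambda>z. fst (snd z)" and a = "(s, s, s)"] F_cont[of n]
    by (cases "k < n") (simp_all add: c_def)
  have J_cont: "isCont J (s, s, s)"
  proof -
    have \<Phi>_cont: "isCont (\<lambda>z. \<Phi> (fst z) (fst (snd z)) k (snd (snd z))) (s, s, s)" for k
      unfolding \<Phi>_def taylor_poly_def by (intro continuous_intros c_cont) auto
    have "isCont (\<lambda>z. case_nat (snd (snd z)) (\<lambda>k. \<Phi> (fst z) (fst (snd z)) k (snd (snd z))) i) (s, s, s)" for i
      by (cases i) (auto intro!: \<Phi>_cont continuous_intros)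
    then show ?thesis
      unfolding J_def ext_jet_def vec_of_eq_sum[OF idx] case_prod_beta
      by (intro continuous_intros \<Phi>_cont) auto
  qed
  have J_s: "J (s, s, s) \<in> S"
    using \<Gamma> \<Gamma>_jet[OF assms(7)] jet_f[of s s] by (auto simp: S_def mem_Times_iff)
  have in_S: "eventually (\<lambda>z. J z \<in> S) (nhds (s, s, s))"
  proof (rule topological_tendstoD[OF _ \<open>open S\<close> J_s])
    show "(J \<longlongrightarrow> J (s, s, s)) (nhds (s, s, s))"
      using J_cont by (simp only: isCont_def tendsto_at_iff_tendsto_nhds)
  qed
  have LJ_cont: "isCont (\<lambda>z. L n (J z)) (s, s, s)"
  proof (rule isCont_o2[OF J_cont])
    show "isCont (L n) (J (s, s, s))"
      using L_cont \<open>open S\<close> J_s by (simp only: continuous_on_eq_continuous_at)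
  qed
  \<comment> \<open>Neighbourhoods in the product are reduced to one radius for all three
    parameters. They are not punctured, since triples with some coordinate equal to \<open>s\<close>
    occur.\<close>
  have cube: "\<exists>d>0. \<forall>x \<eta> t. \<bar>x - s\<bar> < d \<and> \<bar>\<eta> - s\<bar> < d \<and> \<bar>t - s\<bar> < d \<longrightarrow> P (x, \<eta>, t)"
    if ev: "eventually P (nhds (s, s, s))" for P
  proof -
    obtain A R where A: "eventually A (nhds s)" and "eventually R (nhds (s, s))"
      and AR: "\<And>x y. A x \<Longrightarrow> R y \<Longrightarrow> P (x, y)"
      using ev unfolding nhds_prod[of s "(s, s)"] eventually_prod_filter by blast
    then obtain B C where B: "eventually B (nhds s)" and C: "eventually C (nhds s)"
      and BC: "\<And>\<eta> t. B \<eta> \<Longrightarrow> C t \<Longrightarrow> R (\<eta>, t)"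
      unfolding nhds_prod[of s s] eventually_prod_filter by blast
    obtain d where "d > 0" "\<And>x. \<bar>x - s\<bar> < d \<Longrightarrow> A x \<and> B x \<and> C x"
      using eventually_conj[OF A eventually_conj[OF B C]]
      unfolding eventually_nhds_metric dist_real_def by blast
    then show ?thesis
      using AR BC by (intro exI[of _ d]) blast
  qed
  obtain d0 where d0: "d0 > 0"
    "\<And>x \<eta> t. \<bar>x - s\<bar> < d0 \<Longrightarrow> \<bar>\<eta> - s\<bar> < d0 \<Longrightarrow> \<bar>t - s\<bar> < d0 \<Longrightarrow> J (x, \<eta>, t) \<in> S"
    using cube[OF in_S] by blast
  obtain d1 where d1: "d1 > 0" "\<And>x. \<bar>x - s\<bar> < d1 \<Longrightarrow> x \<in> U"
    using assms(4,6) by (auto simp: open_dist dist_real_def)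

  \<comment> \<open>Exact error formula at a fixed point near the zero\<close>
  have key: "\<exists>\<eta> \<xi>. \<bar>\<eta> - s\<bar> < \<bar>x - s\<bar> \<and> \<bar>\<xi> - s\<bar> < \<bar>x - s\<bar> \<and>
      (method_map idx n H f x - s) / (x - s) ^ n = L n (J (x, \<eta>, \<xi>)) / fact n"
    if "x \<noteq> s" "\<bar>x - s\<bar> < min d0 d1" for x
  proof -
    \<comment> \<open>The expansion is about \<open>x\<close> and evaluated at \<open>s\<close>; its
      right-hand side is then the polynomial \<open>\<phi>\<close> at \<open>s\<close>.\<close>
    obtain \<eta> where \<eta>: "\<bar>\<eta> - s\<bar> < \<bar>x - s\<bar>"
      and Taylor_f: "f s = (\<Sum>m<n. F m x / fact m * (s - x) ^ m) + F n \<eta> / fact n * (s - x) ^ n"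
    proof (rule Taylor_between[of n s x F])
      show "(F m has_real_derivative F (Suc m) t) (at t)" if "m < n" "\<bar>t - s\<bar> \<le> \<bar>s - x\<bar>" for m t
        using that \<open>\<bar>x - s\<bar> < min d0 d1\<close> by (intro F_deriv d1(2)) auto
    qed (use assms(1) \<open>x \<noteq> s\<close> in \<open>auto simp: F_def abs_minus_commute\<close>)
    define \<phi> where "\<phi> = \<Phi> x \<eta> 0"
    have in_S': "J (x, \<eta>, t) \<in> S" if "\<bar>t - s\<bar> < d0" for t
      using that \<eta> \<open>\<bar>x - s\<bar> < min d0 d1\<close> by (intro d0(2)) auto
    have "\<phi> s = f s"
      unfolding Taylor_f by (simp add: \<phi>_def \<Phi>_def taylor_poly_def c_def)
    \<comment> \<open>The jet of \<open>\<phi>\<close> at \<open>s\<close> lies in \<open>W\<close>,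
      hence in \<open>Pi_set idx\<close>, and its coordinate 2 is
      \<open>deriv \<phi> s\<close>.\<close>
    moreover have "deriv \<phi> s \<noteq> 0"
      using in_S'[of s] d0(1) W(2) jet_component(3)[of \<phi> s]
      by (auto simp: S_def mem_Times_iff jet_\<Phi> \<phi>_def Pi_set_def)
    ultimately have zero: "simple_zero \<phi> s"
      using assms(7) by (simp add: simple_zero_def)
    \<comment> \<open>Near \<open>s\<close> these are the successive derivatives of
      \<open>method_map idx n H \<phi>\<close>, by \<open>G_0\<close> and
      \<open>G_deriv\<close>.\<close>
    define G where "G k t = L k (J (x, \<eta>, t))" for k t
    have G_0: "G 0 = method_map idx n H \<phi>"
      by (auto simp: G_def L_def jet_\<Phi> \<phi>_def method_map_def)
    have G_deriv: "(G k has_real_derivative G (Suc k) t) (at t)" if "k < n" "\<bar>t - s\<bar> < d0" for k t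
    proof -
      have "(\<Phi> x \<eta> n has_real_derivative 0) (at t)"
        unfolding \<Phi>_n[abs_def] by simp
      then show ?thesis
        using has_real_derivative_flow_deriv[OF idx, of "\<Phi> x \<eta>" t "L k"] assms(1) \<Phi>_deriv
          L_diff[OF that(1) in_S'[OF that(2)]]
        by (simp add: G_def[abs_def] J_def L_def)
    qed
    have G_s: "G i s = 0" if "1 \<le> i" "i < n" for i
    proof -
      have "(deriv ^^ i) (G 0) s = G i s"
        using that d0(1) by (intro funpow_deriv_eq[of "ball s d0" n])
          (auto intro!: G_deriv simp: dist_real_def abs_minus_commute)
      moreover have "C_k_on (2 * n - 2) \<phi> UNIV"
        unfolding \<phi>_def by (rule C_k_on_derivs) (auto intro: \<Phi>_deriv)
      ultimately show ?thesis
        using vanish[OF _ zero that] by (simp add: G_0)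
    qed
    obtain \<xi> where \<xi>: "\<bar>\<xi> - s\<bar> < \<bar>x - s\<bar>"
      and Taylor_G: "G 0 x = (\<Sum>m<n. G m s / fact m * (x - s) ^ m) + G n \<xi> / fact n * (x - s) ^ n"
    proof (rule Taylor_between[of n x s G])
      show "(G m has_real_derivative G (Suc m) t) (at t)" if "m < n" "\<bar>t - s\<bar> \<le> \<bar>x - s\<bar>" for m t
        using that \<open>\<bar>x - s\<bar> < min d0 d1\<close> by (intro G_deriv) auto
    qed (use assms(1) \<open>x \<noteq> s\<close> in auto)
    \<comment> \<open>By condition (b) only the term of order 0 survives, and condition (a) makes it
      equal to \<open>s\<close>.\<close>
    have "(\<Sum>m<n. G m s / fact m * (x - s) ^ m) = (\<Sum>m<n. if m = 0 then G 0 s else 0)"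
      by (rule sum.cong) (auto simp: G_s)
    also have "\<dots> = s"
      using assms(1) fix_zero[OF zero] by (simp add: G_0)
    finally have "G 0 x - s = G n \<xi> / fact n * (x - s) ^ n"
      using Taylor_G by simp
    moreover have "method_map idx n H f x = G 0 x"
      using jet_f[of x \<eta>] by (simp add: G_def L_def method_map_def)
    ultimately show ?thesis
      using \<eta> \<xi> \<open>x \<noteq> s\<close> by (intro exI[of _ \<eta>] exI[of _ \<xi>]) (simp add: G_def)
  qed

  \<comment> \<open>Passage to the limit in the error quotient\<close>
  show ?thesis
  proof (rule converges_with_order_at_leastI[OF assms(1)])
    show "method_map idx n H f s = s" by (rule fix_zero[OF assms(7)])
    show "eventually (\<lambda>x. x \<in> method_dom idx n W f U) (nhds s)"
      unfolding eventually_nhds_metric method_dom_def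
    proof (intro exI[of _ "min d0 d1"] conjI allI impI)
      fix x assume "dist x s < min d0 d1"
      \<comment> \<open>The triple \<open>(x, s, x)\<close> is admissible, and the first component
        of its image under \<open>J\<close> is the jet of \<open>f\<close> at
        \<open>x\<close>.\<close>
      then show "x \<in> {x \<in> U. jet idx n f x \<in> W}"
        using d0(2)[of x s x] d0(1) d1(2)[of x] jet_f[of x s] by (auto simp: S_def mem_Times_iff dist_real_def)
    qed (use d0(1) d1(1) in auto)
    show "((\<lambda>x. (method_map idx n H f x - s) / (x - s) ^ n) \<longlongrightarrow> L n (J (s, s, s)) / fact n) (at s)"
    \<comment> \<open>Both \<open>\<eta>\<close> and \<open>\<xi>\<close> are closer to
      \<open>s\<close> than \<open>x\<close> is, so continuity of \<open>L n\<close> composed with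
      \<open>J\<close> at \<open>(s, s, s)\<close> controls the quotient however they depend on
      \<open>x\<close>.\<close>
    proof (rule LIM_I)
      fix e :: real assume "e > 0"
      have "isCont (\<lambda>z. L n (J z) / fact n) (s, s, s)"
        by (intro continuous_intros LJ_cont) auto
      then have "eventually (\<lambda>z. dist (L n (J z) / fact n) (L n (J (s, s, s)) / fact n) < e) (nhds (s, s, s))"
        using \<open>e > 0\<close> by (auto simp: isCont_def eventually_nhds_conv_at dest: tendstoD)
      from cube[OF this] obtain d2 where d2: "d2 > 0"
        "\<And>x \<eta> t. \<bar>x - s\<bar> < d2 \<Longrightarrow> \<bar>\<eta> - s\<bar> < d2 \<Longrightarrow> \<bar>t - s\<bar> < d2 \<Longrightarrow>
          dist (L n (J (x, \<eta>, t)) / fact n) (L n (J (s, s, s)) / fact n) < e"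
        by blast
      have "norm ((method_map idx n H f x - s) / (x - s) ^ n - L n (J (s, s, s)) / fact n) < e"
        if x: "x \<noteq> s" "norm (x - s) < min d2 (min d0 d1)" for x
      proof -
        obtain \<eta> \<xi> where "\<bar>\<eta> - s\<bar> < \<bar>x - s\<bar>" "\<bar>\<xi> - s\<bar> < \<bar>x - s\<bar>"
          "(method_map idx n H f x - s) / (x - s) ^ n = L n (J (x, \<eta>, \<xi>)) / fact n"
          using key[of x] x by auto
        then show ?thesis
          using d2(2)[of x \<eta> \<xi>] x by (simp add: dist_norm)
      qed
      then show "\<exists>d>0. \<forall>x. x \<noteq> s \<and> norm (x - s) < d \<longrightarrow>
          norm ((method_map idx n H f x - s) / (x - s) ^ n - L n (J (s, s, s)) / fact n) < e"
        using d0(1) d1(1) d2(1) by (intro exI[of _ "min d2 (min d0 d1)"]) auto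
    qed
  qed
qed

end
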